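(* Let $n\geq 2$ be a fixed positive integer. The monoids $\mathrm{stal}$, $\mathrm{stal}_n$, $\mathrm{taig}_n$ and $\mathrm{taig}$ (the stalactic monoid of infinite rank and of rank $n$, and the taiga monoid of rank $n$ and of infinite rank) each generate the same variety of monoids.
   Context: $\mathbb{N}=\{1,2,3,\dots\}$, $[n]=\{1,\dots,n\}$, and $X^*$ is the free monoid on $X$. A stalactic tableau is a finite array of positive integers in which columns are top-aligned and two symbols appear in the same column if and only if they are equal. Insertion of a symbol $a$ into a stalactic tableau $T$: if $a$ does not appear in $T$, add $a$ to the left of the top row of $T$ (as a new leftmost column); if $a$ appears in $T$, add $a$ to the bottom of the unique column containing $a$. For $u\in\mathbb{N}^*$, $\mathrm{P}_{\mathrm{stal}}(u)$ is the tableau obtained from the empty tableau by inserting the symbols of $u$ from right to left. The relation $u\equiv_{\mathrm{stal}}v\iff \mathrm{P}_{\mathrm{stal}}(u)=\mathrm{P}_{\mathrm{stal}}(v)$ is a congruence; $\mathrm{stal}=\mathbb{N}^*/{\equiv_{\mathrm{stal}}}$ and $\mathrm{stal}_n=[n]^*/{\equiv_{\mathrm{stal}}}$. A binary search tree with multiplicities is a (possibly empty) rooted binary tree, with children designated left and right, whose vertices have pairwise distinct positive integer labels, such that the label of each vertex is greater than every label in its left subtree and less than every label in its right subtree, and each vertex label is assigned a positive integer multiplicity. Insertion of a symbol $a$ into such a tree $T$: if $T$ is empty, create a vertex labelled $a$ with multiplicity $1$; otherwise let $x$ be the label of the root; if $a<x$ recursively insert $a$ into the left subtree of the root, if $a>x$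 recursively insert $a$ into the right subtree, and if $a=x$ increase the multiplicity of $x$ by $1$. For $u\in\mathbb{N}^*$, $\mathrm{P}_{\mathrm{taig}}(u)$ is the tree obtained from the empty tree by inserting the symbols of $u$ from right to left. The relation $u\equiv_{\mathrm{taig}}v\iff\mathrm{P}_{\mathrm{taig}}(u)=\mathrm{P}_{\mathrm{taig}}(v)$ is a congruence; $\mathrm{taig}=\mathbb{N}^*/{\equiv_{\mathrm{taig}}}$ and $\mathrm{taig}_n=[n]^*/{\equiv_{\mathrm{taig}}}$. *)

theory Defs
  imports "HOL-Algebra.Product_Groups" "HOL-Library.Tree"
begin

section \<open>Varieties of monoids\<close>

text \<open>\<open>HSP_with I M K\<close>: the monoid \<open>K\<close> is a homomorphic image of a submonoid of the direct
  power \<open>M\<^sup>I\<close>. The library's \<^const>\<open>product_group\<close> is the componentwise product and makes sense for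
  monoids; \<^const>\<open>hom\<close> only asks for compatibility with multiplication, so preservation of the
  identity is stated separately.\<close>

definition HSP_with :: "'i set \<Rightarrow> 'm monoid \<Rightarrow> 'k monoid \<Rightarrow> bool" where
  "HSP_with I M K \<longleftrightarrow> monoid K \<and>
     (\<exists>S f. submonoid S (product_group I (\<lambda>_. M)) \<and>
            f \<in> epi ((product_group I (\<lambda>_. M))\<lparr>carrier := S\<rparr>) K \<and>
            f \<one>\<^bsub>product_group I (\<lambda>_. M)\<^esub> = \<one>\<^bsub>K\<^esub>)"

text \<open>The variety generated by \<open>M\<close>, i.e. the class of all homomorphic images of submonoids of direct
  powers of \<open>M\<close>, restricted to monoids with elements in an arbitrary type \<open>'k\<close>. HOL does not allow
  quantification over the type of the indices; as \<open>HSP_with_imp_generated_variety\<close> below shows,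
  restricting to index sets inside \<open>'k \<Rightarrow> 'm\<close> loses nothing.\<close>

definition generated_variety :: "'m monoid \<Rightarrow> 'k monoid set" where
  "generated_variety M = {K. \<exists>I :: ('k \<Rightarrow> 'm) set. HSP_with I M K}"

lemma product_monoid: "monoid M \<Longrightarrow> monoid (product_group I (\<lambda>_. M))"
  by (intro monoidI; fastforce simp: product_group_def monoid.m_closed monoid.m_assoc
      monoid.one_closed monoid.l_one monoid.r_one PiE_iff extensional_def)

definition word_value :: "('a, 'b) monoid_scheme \<Rightarrow> 'a list \<Rightarrow> 'a" where
  "word_value G w = foldr (monoid.mult G) w \<one>\<^bsub>G\<^esub>"

lemma word_value_simps [simp]:
  "word_value G [] = \<one>\<^bsub>G\<^esub>" "word_value G (x # w) = x \<otimes>\<^bsub>G\<^esub> word_value G w"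
  by (simp_all add: word_value_def)

lemma word_value_closed: "monoid G \<Longrightarrow> set w \<subseteq> carrier G \<Longrightarrow> word_value G w \<in> carrier G"
  by (induction w) (auto simp: monoid.one_closed monoid.m_closed)

lemma word_value_append:
  "monoid G \<Longrightarrow> set u \<subseteq> carrier G \<Longrightarrow> set v \<subseteq> carrier G \<Longrightarrow>
     word_value G (u @ v) = word_value G u \<otimes>\<^bsub>G\<^esub> word_value G v"
  by (induction u) (auto simp: monoid.l_one word_value_closed monoid.m_assoc)

lemma word_value_hom:
  assumes "monoid G" "f \<in> hom G H" "f \<one>\<^bsub>G\<^esub> = \<one>\<^bsub>H\<^esub>" "set w \<subseteq> carrier G"
  shows "f (word_value G w) = word_value H (map f w)"
  using assms(4) by (induction w) (auto simp: assms(3) hom_mult[OF assms(2)] word_value_closed[OF assms(1)])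

lemma word_value_carrier_update [simp]: "word_value (G\<lparr>carrier := S\<rparr>) w = word_value G w"
  by (simp add: word_value_def)

lemma word_value_product:
  assumes "monoid M" "set w \<subseteq> carrier (product_group I (\<lambda>_. M))" "i \<in> I"
  shows "word_value (product_group I (\<lambda>_. M)) w i = word_value M (map (\<lambda>x. x i) w)"
  using assms(2,3) by (induction w) (auto simp: product_group_def)

lemma HSP_with_imp_generated_variety:
  fixes I :: "'i set" and M :: "'m monoid" and K :: "'k monoid"
  assumes M: "monoid M" and HSP: "HSP_with I M K"
  shows "K \<in> generated_variety M"
proof -
  define P where "P = product_group I (\<lambda>_. M)"
  obtain S f where K: "monoid K" and S: "submonoid S P" and f: "f \<in> epi (P\<lparr>carrier := S\<rparr>) K"
    and f1: "f \<one>\<^bsub>P\<^esub> = \<one>\<^bsub>K\<^esub>"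
    using HSP unfolding HSP_with_def P_def by blast
  interpret K: monoid K by (rule K)
  have P: "monoid P" unfolding P_def by (rule product_monoid[OF M])
  have SM: "monoid (P\<lparr>carrier := S\<rparr>)"
    using submonoid.submonoid_is_monoid[OF S P] .
  have carP: "carrier P = (\<Pi>\<^sub>E i\<in>I. carrier M)" by (simp add: P_def product_group_def)
  have SP: "S \<subseteq> carrier P" by (rule submonoid.subset[OF S])
  have fh: "f \<in> hom (P\<lparr>carrier := S\<rparr>) K" and fs: "f ` S = carrier K"
    using f by (auto simp: epi_def)
  define s where "s = inv_into S f"
  have s: "s k \<in> S" "f (s k) = k" if "k \<in> carrier K" for k
    using that fs inv_into_into[of k f S] f_inv_into_f[of k f S] unfolding s_def by auto
  define J :: "('k \<Rightarrow> 'm) set" where "J = carrier K \<rightarrow> carrier M"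
  define Q where "Q = product_group J (\<lambda>_. M)"
  have Q: "monoid Q" unfolding Q_def by (rule product_monoid[OF M])
  interpret Q: monoid Q by (rule Q)
  define g where "g k = (\<lambda>\<theta>\<in>J. \<theta> k)" for k
  have g: "g k \<in> carrier Q" if "k \<in> carrier K" for k
    using that by (auto simp: g_def Q_def product_group_def J_def)
  let ?W = "{w. set w \<subseteq> carrier K}"
  define ev where "ev w = word_value Q (map g w)" for w
  have evc: "ev w \<in> carrier Q" if "w \<in> ?W" for w
    unfolding ev_def using that g by (intro word_value_closed[OF Q]) auto
  have evapp: "ev (u @ v) = ev u \<otimes>\<^bsub>Q\<^esub> ev v" if "u \<in> ?W" "v \<in> ?W" for u v
    unfolding ev_def map_append using that g by (intro word_value_append[OF Q]) auto
  have evJ: "ev w \<theta> = word_value M (map \<theta> w)" if "w \<in> ?W" "\<theta> \<in> J" for w \<theta>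
  proof -
    have "ev w \<theta> = word_value M (map (\<lambda>x. x \<theta>) (map g w))"
      unfolding ev_def Q_def using that g by (intro word_value_product[OF M]) (auto simp: Q_def)
    also have "map (\<lambda>x. x \<theta>) (map g w) = map \<theta> w" using that by (simp add: g_def)
    finally show ?thesis .
  qed
  have sW: "set (map s w) \<subseteq> S" if "w \<in> ?W" for w using that s by auto
  have fv: "f (word_value P (map s w)) = word_value K w" if "w \<in> ?W" for w
  proof -
    have "f (word_value (P\<lparr>carrier := S\<rparr>) (map s w)) = word_value K (map f (map s w))"
      using sW[OF that] f1 by (intro word_value_hom[OF SM fh]) auto
    also have "map f (map s w) = w" using that s(2) by (auto intro!: map_idI)
    finally show ?thesis by simp
  qed
  have wd: "word_value K u = word_value K v" if uv: "u \<in> ?W" "v \<in> ?W" and eq: "ev u = ev v" for u v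
  proof -
    have "word_value P (map s u) = word_value P (map s v)"
    proof (rule PiE_ext)
      show "word_value P (map s u) \<in> (\<Pi>\<^sub>E i\<in>I. carrier M)"
           "word_value P (map s v) \<in> (\<Pi>\<^sub>E i\<in>I. carrier M)"
        unfolding carP[symmetric]
        by (intro word_value_closed[OF P] subset_trans[OF sW SP] uv)+
      fix i assume i: "i \<in> I"
      define \<theta> where "\<theta> = (\<lambda>k. s k i)"
      have \<theta>: "\<theta> \<in> J"
        using s(1) SP i unfolding J_def \<theta>_def carP by (auto intro: PiE_mem)
      have *: "word_value P (map s w) i = word_value M (map \<theta> w)" if "w \<in> ?W" for w
        using word_value_product[OF M _ i, of "map s w"] subset_trans[OF sW[OF that] SP]
        unfolding P_def \<theta>_def by (simp add: o_def)
      show "word_value P (map s u) i = word_value P (map s v) i"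
        using *[OF uv(1)] *[OF uv(2)] evJ[OF uv(1) \<theta>] evJ[OF uv(2) \<theta>] eq by simp
    qed
    then show ?thesis using fv[OF uv(1)] fv[OF uv(2)] by simp
  qed
  define h where "h x = word_value K (SOME w. w \<in> ?W \<and> ev w = x)" for x
  have h: "h (ev w) = word_value K w" if "w \<in> ?W" for w
  proof -
    have "(SOME w'. w' \<in> ?W \<and> ev w' = ev w) \<in> ?W \<and> ev (SOME w'. w' \<in> ?W \<and> ev w' = ev w) = ev w"
      by (rule someI[of _ w]) (use that in simp)
    then show ?thesis unfolding h_def using wd that by blast
  qed
  have ev0: "ev [] = \<one>\<^bsub>Q\<^esub>" by (simp add: ev_def)
  have T: "submonoid (ev ` ?W) Q"
  proof
    show "ev ` ?W \<subseteq> carrier Q" using evc by auto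
    show "\<one>\<^bsub>Q\<^esub> \<in> ev ` ?W" using ev0 by (auto intro!: image_eqI[of _ _ "[]"])
    fix x y assume "x \<in> ev ` ?W" "y \<in> ev ` ?W"
    then obtain u v where "u \<in> ?W" "v \<in> ?W" "x = ev u" "y = ev v" by auto
    then show "x \<otimes>\<^bsub>Q\<^esub> y \<in> ev ` ?W"
      using evapp[of u v] by (auto intro!: image_eqI[of _ _ "u @ v"])
  qed
  have hh: "h \<in> hom (Q\<lparr>carrier := ev ` ?W\<rparr>) K"
  proof (rule homI; clarsimp)
    fix u assume "set u \<subseteq> carrier K"
    then show "h (ev u) \<in> carrier K" using h word_value_closed[OF K] by simp
  next
    fix u v assume uv: "set u \<subseteq> carrier K" "set v \<subseteq> carrier K"
    then have "h (ev u \<otimes>\<^bsub>Q\<^esub> ev v) = h (ev (u @ v))" by (simp add: evapp)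
    also have "\<dots> = word_value K (u @ v)" using uv by (intro h) simp
    also have "\<dots> = h (ev u) \<otimes>\<^bsub>K\<^esub> h (ev v)" using uv by (simp add: h word_value_append[OF K])
    finally show "h (ev u \<otimes>\<^bsub>Q\<^esub> ev v) = h (ev u) \<otimes>\<^bsub>K\<^esub> h (ev v)" .
  qed
  have "k \<in> h ` ev ` ?W" if "k \<in> carrier K" for k
    using h[of "[k]"] that by (auto intro!: image_eqI[of k h "ev [k]"])
  then have "h ` ev ` ?W = carrier K"
    using hh by (auto simp: hom_def)
  then have "h \<in> epi (Q\<lparr>carrier := ev ` ?W\<rparr>) K" using hh by (simp add: epi_def)
  moreover have "h \<one>\<^bsub>Q\<^esub> = \<one>\<^bsub>K\<^esub>" using h[of "[]"] ev0 by simp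
  ultimately have "HSP_with J M K" unfolding HSP_with_def Q_def[symmetric] using K T by blast
  then show ?thesis unfolding generated_variety_def by blast
qed


section \<open>Quotients of free monoids\<close>

text \<open>For \<open>P\<close> a map on words, the quotient of the free monoid \<open>A\<^sup>*\<close> by the kernel of \<open>P\<close>. The union in
  the multiplication is the single class of \<open>u @ v\<close> whenever the kernel is a congruence.\<close>

definition word_kernel :: "'a set \<Rightarrow> ('a list \<Rightarrow> 'b) \<Rightarrow> ('a list \<times> 'a list) set" where
  "word_kernel A P = {(u, v). u \<in> lists A \<and> v \<in> lists A \<and> P u = P v}"

definition word_quotient :: "'a set \<Rightarrow> ('a list \<Rightarrow> 'b) \<Rightarrow> 'a list set monoid" where
  "word_quotient A P =
     \<lparr>carrier = lists A // word_kernel A P,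
      monoid.mult = (\<lambda>X Y. \<Union>u\<in>X. \<Union>v\<in>Y. word_kernel A P `` {u @ v}),
      one = word_kernel A P `` {[]}\<rparr>"


section \<open>Stalactic monoids\<close>

text \<open>A stalactic tableau is the list of its columns from left to right; a column is the list of its
  entries from top to bottom.\<close>

definition stal_insert :: "nat \<Rightarrow> nat list list \<Rightarrow> nat list list" where
  "stal_insert a T =
     (if a \<in> \<Union> (set ` set T) then map (\<lambda>c. if a \<in> set c then c @ [a] else c) T
      else [a] # T)"

definition P_stal :: "nat list \<Rightarrow> nat list list" where
  "P_stal u = foldr stal_insert u []"

definition stal :: "nat list set monoid" where
  "stal = word_quotient {1..} P_stal"

definition stal_rank :: "nat \<Rightarrow> nat list set monoid" where
  "stal_rank n = word_quotient {1..n} P_stal"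


section \<open>Taiga monoids\<close>

text \<open>Vertices carry pairs (label, multiplicity).\<close>

fun taig_insert :: "nat \<Rightarrow> (nat \<times> nat) tree \<Rightarrow> (nat \<times> nat) tree" where
  "taig_insert a Leaf = Node Leaf (a, 1) Leaf"
| "taig_insert a (Node l (x, m) r) =
     (if a < x then Node (taig_insert a l) (x, m) r
      else if a > x then Node l (x, m) (taig_insert a r)
      else Node l (x, m + 1) r)"

definition P_taig :: "nat list \<Rightarrow> (nat \<times> nat) tree" where
  "P_taig u = foldr taig_insert u Leaf"

definition taig :: "nat list set monoid" where
  "taig = word_quotient {1..} P_taig"

definition taig_rank :: "nat \<Rightarrow> nat list set monoid" where
  "taig_rank n = word_quotient {1..n} P_taig"

end

theory Submission
  imports Defs
begin

text \<open>A stalactic tableau records two things about a word: how often each letter occurs, and in which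
  order the last occurrences of the letters appear (\<open>P_stal_eq_iff\<close>; the library function
  \<^const>\<open>remdups\<close> keeps exactly the last occurrences). The order of a list without repetitions is
  known as soon as one knows, for every pair \<open>{a, b}\<close> of letters, which of the two comes last. So a
  word is determined up to stalactic equivalence by its images under the homomorphisms that erase all
  letters but \<open>a\<close> and \<open>b\<close> and rename these to \<open>1\<close> and \<open>2\<close>, and of each image one needs only the
  number of occurrences of each letter and the last letter.

  The taiga congruence lies between the two extremes that meet here. It is coarser than the stalactic
  one, because the root of the tree is the last letter of the word and its subtrees are built in the
  same way from the smaller and from the larger letters (\<open>P_taig_snoc\<close>), and it still determines the
  multiplicities and the last letter. Hence for \<open>P\<close> and \<open>Q\<close> among the two insertion maps, two
  words have equal \<open>P\<close>-values if all their images have equal \<open>Q\<close>-values. This makes \<open>A\<^sup>*/P\<close> a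
  homomorphic image of a submonoid of a power of \<open>B\<^sup>*/Q\<close> whenever \<open>B\<close> contains \<open>1\<close> and \<open>2\<close>
  (\<open>generated_variety_subset\<close>), so each of the quotients in question lies in the varieties generated
  by the others.

  Two points need separate work: that being in the generated variety is transitive
  (\<open>HSP_with_trans\<close>), and that the taiga relation is a congruence (\<open>word_congruence_P_taig\<close>). The
  latter holds because inserting a word into a tree splits the word at the root into its smaller and
  its larger letters, and the tree of a word already determines the trees of these two subwords.\<close>


section \<open>Generated varieties\<close>

text \<open>If \<open>N = g(T)\<close> with \<open>T \<le> M\<^sup>J\<close> and \<open>K = f(S)\<close> with \<open>S \<le> N\<^sup>I\<close>, view an element of
  \<open>M\<^bsup>I\<times>J\<^esup>\<close> as a matrix. The matrices with rows in \<open>T\<close> whose rowwise image under \<open>g\<close> lies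
  in \<open>S\<close> form a submonoid, and applying \<open>g\<close> to the rows and then \<open>f\<close> maps it onto \<open>K\<close>.\<close>

lemma HSP_with_trans:
  fixes I :: "'i set" and J :: "'j set"
    and M :: "'m monoid" and N :: "'n monoid" and K :: "'k monoid"
  assumes MN: "HSP_with J M N" and NK: "HSP_with I N K"
  shows "HSP_with (I \<times> J) M K"
proof -
  let ?MJ = "product_group J (\<lambda>_. M)" and ?NI = "product_group I (\<lambda>_. N)"
  let ?MIJ = "product_group (I \<times> J) (\<lambda>_. M)"
  \<comment> \<open>Products are to be rewritten as products of rows, not entry by entry.\<close>
  note [simp del] = mult_product_group one_product_group
  from MN obtain T g where T: "submonoid T ?MJ" and g: "g \<in> epi (?MJ\<lparr>carrier := T\<rparr>) N"
    and g1: "g \<one>\<^bsub>?MJ\<^esub> = \<one>\<^bsub>N\<^esub>"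
    unfolding HSP_with_def by blast
  from NK obtain S f where K: "monoid K" and S: "submonoid S ?NI"
    and f: "f \<in> epi (?NI\<lparr>carrier := S\<rparr>) K" and f1: "f \<one>\<^bsub>?NI\<^esub> = \<one>\<^bsub>K\<^esub>"
    unfolding HSP_with_def by blast
  note T_sub = submonoid.subset[OF T, unfolded carrier_product_group]
  note S_sub = submonoid.subset[OF S, unfolded carrier_product_group]
  have g_mult: "g (x \<otimes>\<^bsub>?MJ\<^esub> y) = g x \<otimes>\<^bsub>N\<^esub> g y" if "x \<in> T" "y \<in> T" for x y
    using g that by (auto simp: epi_def hom_def)
  have g_onto: "g ` T = carrier N" using g by (auto simp: epi_def)
  have f_mult: "f (x \<otimes>\<^bsub>?NI\<^esub> y) = f x \<otimes>\<^bsub>K\<^esub> f y" if "x \<in> S" "y \<in> S" for x y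
    using f that by (auto simp: epi_def hom_def)
  have f_onto: "f ` S = carrier K" using f by (auto simp: epi_def)
  define row where "row x i = (\<lambda>j\<in>J. x (i, j))" for x :: "'i \<times> 'j \<Rightarrow> 'm" and i
  define G where "G x = (\<lambda>i\<in>I. g (row x i))" for x
  define U where "U = {x \<in> carrier ?MIJ. (\<forall>i\<in>I. row x i \<in> T) \<and> G x \<in> S}"
  have row_mult: "row (x \<otimes>\<^bsub>?MIJ\<^esub> y) i = row x i \<otimes>\<^bsub>?MJ\<^esub> row y i" if "i \<in> I" for x y i
    using that by (auto simp: row_def mult_product_group)
  have row_one: "row \<one>\<^bsub>?MIJ\<^esub> i = \<one>\<^bsub>?MJ\<^esub>" if "i \<in> I" for i
    using that by (auto simp: row_def one_product_group)
  have G_mult: "G (x \<otimes>\<^bsub>?MIJ\<^esub> y) = G x \<otimes>\<^bsub>?NI\<^esub> G y" if "x \<in> U" "y \<in> U" for x y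
    using that by (intro ext) (simp add: G_def row_mult g_mult U_def mult_product_group[where I = I])
  have G_one: "G \<one>\<^bsub>?MIJ\<^esub> = \<one>\<^bsub>?NI\<^esub>"
    by (auto simp: G_def row_one g1 one_product_group[where I = I])
  have mult_closed: "x \<otimes>\<^bsub>?MIJ\<^esub> y \<in> U" if xy: "x \<in> U" "y \<in> U" for x y
  proof -
    have rows: "row (x \<otimes>\<^bsub>?MIJ\<^esub> y) i \<in> T" if "i \<in> I" for i
      using xy that submonoid.m_closed[OF T] by (auto simp: U_def row_mult)
    have "(x \<otimes>\<^bsub>?MIJ\<^esub> y) (i, j) \<in> carrier M" if "i \<in> I" "j \<in> J" for i j
    proof -
      have "(x \<otimes>\<^bsub>?MIJ\<^esub> y) (i, j) = row (x \<otimes>\<^bsub>?MIJ\<^esub> y) i j" using that by (simp add: row_def)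
      then show ?thesis using rows[OF that(1)] T_sub that(2) by auto
    qed
    then have "x \<otimes>\<^bsub>?MIJ\<^esub> y \<in> carrier ?MIJ"
      by (auto simp: PiE_iff mult_product_group)
    then show ?thesis
      using rows xy G_mult[OF xy] submonoid.m_closed[OF S] by (auto simp: U_def)
  qed
  have one_closed: "\<one>\<^bsub>?MIJ\<^esub> \<in> U"
  proof -
    have "\<one>\<^bsub>M\<^esub> \<in> carrier M" if "j \<in> J" for j
      using submonoid.one_closed[OF T] T_sub that by (force simp: one_product_group)
    then have "\<one>\<^bsub>?MIJ\<^esub> \<in> carrier ?MIJ" by (auto simp: one_product_group)
    then show ?thesis
      using submonoid.one_closed[OF T] submonoid.one_closed[OF S]
      by (simp add: U_def row_one G_one)
  qed
  have U: "submonoid U ?MIJ"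
    by unfold_locales (use mult_closed one_closed in \<open>auto simp: U_def\<close>)
  have G_onto: "G ` U = S"
  proof
    show "G ` U \<subseteq> S" by (auto simp: U_def)
    show "S \<subseteq> G ` U"
    proof
      fix s assume s: "s \<in> S"
      then have s_in: "s i \<in> g ` T" if "i \<in> I" for i using S_sub that g_onto by auto
      define x where "x = (\<lambda>(i, j)\<in>I \<times> J. inv_into T g (s i) j)"
      have rows: "row x i = inv_into T g (s i)" if "i \<in> I" for i
        using T_sub inv_into_into[OF s_in[OF that]] that
        by (auto simp: row_def x_def fun_eq_iff PiE_iff extensional_def)
      have "x \<in> carrier ?MIJ"
        using T_sub inv_into_into[OF s_in] by (fastforce simp: x_def PiE_iff)
      moreover have "G x = s"
        using s S_sub f_inv_into_f[OF s_in]
        by (auto simp: G_def rows fun_eq_iff PiE_iff extensional_def)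
      ultimately have "x \<in> U" using s rows inv_into_into[OF s_in] by (simp add: U_def)
      then show "s \<in> G ` U" using \<open>G x = s\<close> by blast
    qed
  qed
  have "f \<circ> G \<in> epi (?MIJ\<lparr>carrier := U\<rparr>) K"
  proof -
    have "(f \<circ> G) ` U = carrier K" using G_onto f_onto by (metis image_comp)
    moreover have "f (G (x \<otimes>\<^bsub>?MIJ\<^esub> y)) = f (G x) \<otimes>\<^bsub>K\<^esub> f (G y)" if "x \<in> U" "y \<in> U" for x y
      using that G_onto by (auto simp: G_mult f_mult)
    ultimately show ?thesis by (auto simp: epi_def hom_def)
  qed
  moreover have "(f \<circ> G) \<one>\<^bsub>?MIJ\<^esub> = \<one>\<^bsub>K\<^esub>" by (simp add: G_one f1)
  ultimately show ?thesis unfolding HSP_with_def using K U by blast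
qed

lemma generated_variety_mono:
  fixes M :: "'m monoid" and N :: "'n monoid"
  assumes "monoid M" and "HSP_with J M N"
  shows "(generated_variety N :: 'k monoid set) \<subseteq> generated_variety M"
proof
  fix K :: "'k monoid" assume "K \<in> generated_variety N"
  then obtain I :: "('k \<Rightarrow> 'n) set" where "HSP_with I N K" by (auto simp: generated_variety_def)
  then show "K \<in> generated_variety M"
    by (rule HSP_with_imp_generated_variety[OF assms(1) HSP_with_trans[OF assms(2)]])
qed


section \<open>Quotients of free monoids\<close>

definition word_congruence :: "('a list \<Rightarrow> 'b) \<Rightarrow> bool" where
  "word_congruence P \<longleftrightarrow>
     (\<forall>u u' v v'. P u = P u' \<longrightarrow> P v = P v' \<longrightarrow> P (u @ v) = P (u' @ v'))"

lemma equiv_word_kernel: "equiv (lists A) (word_kernel A P)"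
  by (rule equivI) (auto simp: word_kernel_def refl_on_def sym_def trans_def)

lemma word_class_eq_iff:
  assumes "u \<in> lists A" "v \<in> lists A"
  shows "word_kernel A P `` {u} = word_kernel A P `` {v} \<longleftrightarrow> P u = P v"
  using eq_equiv_class_iff[OF equiv_word_kernel assms, of P] assms by (simp add: word_kernel_def)

lemma carrier_word_quotient:
  "carrier (word_quotient A P) = (\<lambda>u. word_kernel A P `` {u}) ` lists A"
  by (auto simp: word_quotient_def quotient_def)

lemma one_word_quotient: "\<one>\<^bsub>word_quotient A P\<^esub> = word_kernel A P `` {[]}"
  by (simp add: word_quotient_def)

lemma mult_word_quotient:
  assumes "word_congruence P" "u \<in> lists A" "v \<in> lists A"
  shows "word_kernel A P `` {u} \<otimes>\<^bsub>word_quotient A P\<^esub> word_kernel A P `` {v}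
           = word_kernel A P `` {u @ v}"
proof -
  have "word_kernel A P `` {u' @ v'} = word_kernel A P `` {u @ v}"
    if "u' \<in> word_kernel A P `` {u}" "v' \<in> word_kernel A P `` {v}" for u' v'
  proof -
    have words: "u' \<in> lists A" "v' \<in> lists A" and "P u' = P u" "P v' = P v"
      using that by (auto simp: word_kernel_def)
    then have "P (u' @ v') = P (u @ v)" using assms(1) unfolding word_congruence_def by blast
    with words assms show ?thesis by (simp add: word_class_eq_iff)
  qed
  moreover have "u \<in> word_kernel A P `` {u}" "v \<in> word_kernel A P `` {v}"
    using assms by (auto simp: word_kernel_def)
  ultimately have "(\<Union>u'\<in>word_kernel A P `` {u}. \<Union>v'\<in>word_kernel A P `` {v}.
      word_kernel A P `` {u' @ v'}) = word_kernel A P `` {u @ v}"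
    by blast
  then show ?thesis by (simp add: word_quotient_def)
qed

lemma monoid_word_quotient:
  assumes "word_congruence P"
  shows "monoid (word_quotient A P)"
proof (rule monoidI; unfold carrier_word_quotient one_word_quotient)
  show "word_kernel A P `` {[]} \<in> (\<lambda>u. word_kernel A P `` {u}) ` lists A"
    by (rule imageI) simp
next
  fix x y
  assume "x \<in> (\<lambda>u. word_kernel A P `` {u}) ` lists A" "y \<in> (\<lambda>u. word_kernel A P `` {u}) ` lists A"
  then obtain u v where uv: "u \<in> lists A" "v \<in> lists A"
    "x = word_kernel A P `` {u}" "y = word_kernel A P `` {v}" by (elim imageE)
  then have "x \<otimes>\<^bsub>word_quotient A P\<^esub> y = word_kernel A P `` {u @ v}"
    using mult_word_quotient[OF assms] by simp
  with uv(1,2) show "x \<otimes>\<^bsub>word_quotient A P\<^esub> y \<in> (\<lambda>u. word_kernel A P `` {u}) ` lists A"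
    by (intro image_eqI[of _ _ "u @ v"]) simp_all
qed (elim imageE; simp add: mult_word_quotient[OF assms])+

text \<open>A family of homomorphisms \<open>\<phi>\<^sub>i : A\<^sup>* \<rightarrow> B\<^sup>*\<close> maps \<open>A\<^sup>*\<close> into the power \<open>(B\<^sup>*/Q)\<^sup>I\<close>. If \<open>P\<close> is
  constant on the fibres of this map, then \<open>A\<^sup>*/P\<close> is a homomorphic image of its range.\<close>

lemma HSP_with_word_quotient:
  assumes P: "word_congruence P" and Q: "word_congruence Q"
    and closed: "\<And>i u. i \<in> I \<Longrightarrow> u \<in> lists A \<Longrightarrow> \<phi> i u \<in> lists B"
    and append: "\<And>i u v. i \<in> I \<Longrightarrow> \<phi> i (u @ v) = \<phi> i u @ \<phi> i v"
    and separating: "\<And>u v. u \<in> lists A \<Longrightarrow> v \<in> lists A \<Longrightarrow>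
           (\<And>i. i \<in> I \<Longrightarrow> Q (\<phi> i u) = Q (\<phi> i v)) \<Longrightarrow> P u = P v"
  shows "HSP_with I (word_quotient B Q) (word_quotient A P)"
proof -
  let ?M = "word_quotient B Q" and ?K = "word_quotient A P"
  let ?MI = "product_group I (\<lambda>_. ?M)"
  note [simp del] = mult_product_group one_product_group
  define e where "e u = (\<lambda>i\<in>I. word_kernel B Q `` {\<phi> i u})" for u
  define f where "f x = word_kernel A P `` {inv_into (lists A) e x}" for x
  have Nil: "\<phi> i [] = []" if "i \<in> I" for i using append[OF that, of "[]" "[]"] by simp
  have e_append: "e (u @ v) = e u \<otimes>\<^bsub>?MI\<^esub> e v" if "u \<in> lists A" "v \<in> lists A" for u v
    by (rule ext) (simp add: e_def mult_product_group append mult_word_quotient[OF Q] closed that)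
  have e_Nil: "e [] = \<one>\<^bsub>?MI\<^esub>"
    by (rule ext) (simp add: e_def one_product_group Nil one_word_quotient)
  have f_e: "f (e u) = word_kernel A P `` {u}" if u: "u \<in> lists A" for u
  proof -
    define v where "v = inv_into (lists A) e (e u)"
    have "e u \<in> e ` lists A" using u by (rule imageI)
    then have v: "v \<in> lists A" "e v = e u"
      unfolding v_def by (rule inv_into_into, rule f_inv_into_f)
    have "Q (\<phi> i v) = Q (\<phi> i u)" if "i \<in> I" for i
      using fun_cong[OF v(2), of i] that closed u v(1) by (simp add: e_def word_class_eq_iff)
    then have "P v = P u" by (rule separating[OF v(1) u])
    then show ?thesis using u v(1) by (simp add: f_def v_def[symmetric] word_class_eq_iff)
  qed
  have "submonoid (e ` lists A) ?MI"
  proof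
    have "word_kernel B Q `` {\<phi> i u} \<in> carrier ?M" if "i \<in> I" "u \<in> lists A" for i u
      unfolding carrier_word_quotient using closed[OF that] by (rule imageI)
    then have "e u \<in> carrier ?MI" if "u \<in> lists A" for u using that by (simp add: e_def)
    then show "e ` lists A \<subseteq> carrier ?MI" by blast
    show "\<one>\<^bsub>?MI\<^esub> \<in> e ` lists A" unfolding e_Nil[symmetric] by (rule imageI) simp
    fix x y assume "x \<in> e ` lists A" "y \<in> e ` lists A"
    then obtain u v where uv: "u \<in> lists A" "v \<in> lists A" "x = e u" "y = e v" by (elim imageE)
    then show "x \<otimes>\<^bsub>?MI\<^esub> y \<in> e ` lists A"
      by (intro image_eqI[of _ _ "u @ v"]) (simp_all add: e_append)
  qed
  moreover have "f \<in> epi (?MI\<lparr>carrier := e ` lists A\<rparr>) ?K"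
  proof -
    have "f ` e ` lists A = carrier ?K"
      by (simp add: carrier_word_quotient image_image f_e cong: image_cong)
    moreover have "f (e u \<otimes>\<^bsub>?MI\<^esub> e v) = f (e u) \<otimes>\<^bsub>?K\<^esub> f (e v)"
      if uv: "u \<in> lists A" "v \<in> lists A" for u v
    proof -
      have "f (e (u @ v)) = word_kernel A P `` {u @ v}" using uv by (intro f_e) simp
      then show ?thesis using uv by (simp add: e_append f_e mult_word_quotient[OF P])
    qed
    ultimately show ?thesis by (auto simp: epi_def hom_def)
  qed
  moreover have "f \<one>\<^bsub>?MI\<^esub> = \<one>\<^bsub>?K\<^esub>"
    unfolding e_Nil[symmetric] by (simp add: f_e one_word_quotient)
  ultimately show ?thesis unfolding HSP_with_def using monoid_word_quotient[OF P] by blast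
qed


section \<open>Congruences determined by content and last occurrences\<close>

text \<open>The class of congruences to which the argument applies: the equivalence class of a word
  determines its content and last letter, and is determined by its content and the order of last
  occurrences. On a two-letter alphabet these bounds coincide, which is why all such congruences
  generate one variety. The value of \<^const>\<open>last\<close> at the empty word is immaterial because the content
  already tells whether a word is empty.\<close>

definition last_occurrence_congruence :: "(nat list \<Rightarrow> 'b) \<Rightarrow> bool" where
  "last_occurrence_congruence P \<longleftrightarrow> word_congruence P \<and>
     (\<forall>u v. P u = P v \<longrightarrow> count_list u = count_list v \<and> last u = last v) \<and>
     (\<forall>u v. count_list u = count_list v \<longrightarrow> remdups u = remdups v \<longrightarrow> P u = P v)"

text \<open>Taking \<open>a\<close> and \<open>b\<close> to be the last entries of the two lists shows that these agree. Removing
  the common last entry does not change the restrictions to pairs of the remaining entries.\<close>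

lemma distinct_eqI_pairwise_last:
  assumes "distinct xs" "distinct ys" "set xs = set ys"
    and "\<And>a b. a \<in> set xs \<Longrightarrow> b \<in> set xs \<Longrightarrow>
           last (filter (\<lambda>x. x = a \<or> x = b) xs) = last (filter (\<lambda>x. x = a \<or> x = b) ys)"
  shows "xs = ys"
  using assms
proof (induction xs arbitrary: ys rule: rev_induct)
  case Nil
  then show ?case by simp
next
  case (snoc z xs)
  from snoc.prems(3) have "ys \<noteq> []" by auto
  then obtain ys' z' where ys: "ys = ys' @ [z']" by (cases ys rule: rev_cases) auto
  have "z' \<in> set (xs @ [z])" using snoc.prems(3) ys by auto
  then have "z = z'" using snoc.prems(4)[of z z'] ys by simp
  moreover have "xs = ys'"
  proof (rule snoc.IH)
    show "distinct xs" "distinct ys'" "set xs = set ys'"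
      using snoc.prems(1-3) ys \<open>z = z'\<close> by auto
    fix a b assume "a \<in> set xs" "b \<in> set xs"
    moreover from this have "z \<noteq> a" "z \<noteq> b" using snoc.prems(1) by auto
    ultimately show "last (filter (\<lambda>x. x = a \<or> x = b) xs) = last (filter (\<lambda>x. x = a \<or> x = b) ys')"
      using snoc.prems(4)[of a b] ys \<open>z = z'\<close> by simp
  qed
  ultimately show ?case using ys by simp
qed

lemma last_remdups: "last (remdups u) = last u"
  by (induction u) auto

lemma remdups_eqI_pairwise_last:
  assumes "set u = set v"
    and "\<And>a b. a \<in> set u \<Longrightarrow> b \<in> set u \<Longrightarrow>
           last (filter (\<lambda>x. x = a \<or> x = b) u) = last (filter (\<lambda>x. x = a \<or> x = b) v)"
  shows "remdups u = remdups v"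
proof (rule distinct_eqI_pairwise_last)
  fix a b assume "a \<in> set (remdups u)" "b \<in> set (remdups u)"
  then show "last (filter (\<lambda>x. x = a \<or> x = b) (remdups u)) =
             last (filter (\<lambda>x. x = a \<or> x = b) (remdups v))"
    using assms(2)[of a b] by (simp add: remdups_filter[symmetric] last_remdups)
qed (use assms(1) in auto)

text \<open>For \<open>a = b\<close> the image is a power of the letter \<open>1\<close>, so that multiplicities of letters are
  detected even over an alphabet with a single letter.\<close>

definition pair_projection :: "nat \<times> nat \<Rightarrow> nat list \<Rightarrow> nat list" where
  "pair_projection = (\<lambda>(a, b) u. map (\<lambda>x. if x = a then 1 else 2) (filter (\<lambda>x. x = a \<or> x = b) u))"

lemma count_list_pair_projection: "count_list (pair_projection (a, b) u) 1 = count_list u a"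
  by (induction u) (auto simp: pair_projection_def)

lemma last_pair_projection:
  assumes "a \<in> set u"
  shows "last (pair_projection (a, b) u) =
           (if last (filter (\<lambda>x. x = a \<or> x = b) u) = a then 1 else 2)"
proof -
  have "filter (\<lambda>x. x = a \<or> x = b) u \<noteq> []" using assms by (auto simp: filter_empty_conv)
  then show ?thesis by (simp add: pair_projection_def last_map)
qed

lemma set_eq_count_list_pos: "set u = {a. count_list u a \<noteq> 0}"
  by (auto simp: count_list_0_iff)

lemma pair_projections_separate:
  assumes u: "u \<in> lists A" and v: "v \<in> lists A"
    and count: "\<And>a b. a \<in> A \<Longrightarrow> b \<in> A \<Longrightarrow>
      count_list (pair_projection (a, b) u) = count_list (pair_projection (a, b) v)"
    and last: "\<And>a b. a \<in> A \<Longrightarrow> b \<in> A \<Longrightarrow>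
      last (pair_projection (a, b) u) = last (pair_projection (a, b) v)"
  shows "count_list u = count_list v" "remdups u = remdups v"
proof -
  show cnt: "count_list u = count_list v"
  proof
    fix a show "count_list u a = count_list v a"
    proof (cases "a \<in> A")
      case True
      then show ?thesis using count[of a a] count_list_pair_projection[of a a] by metis
    next
      case False
      then have "a \<notin> set u" "a \<notin> set v" using u v by auto
      then show ?thesis by simp
    qed
  qed
  then have sets: "set u = set v" by (metis set_eq_count_list_pos)
  show "remdups u = remdups v"
  proof (rule remdups_eqI_pairwise_last[OF sets])
    fix a b assume ab: "a \<in> set u" "b \<in> set u"
    let ?F = "\<lambda>w. filter (\<lambda>x. x = a \<or> x = b) w"
    have "?F u \<noteq> []" "?F v \<noteq> []" using ab sets by (auto simp: filter_empty_conv)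
    then have "last (?F u) \<in> {a, b}" "last (?F v) \<in> {a, b}"
      using last_in_set[of "?F u"] last_in_set[of "?F v"] by auto
    moreover have "last (?F u) = a \<longleftrightarrow> last (?F v) = a"
      using last[of a b] ab u sets last_pair_projection[of a u b] last_pair_projection[of a v b]
      by (auto split: if_splits)
    ultimately show "last (?F u) = last (?F v)" by auto
  qed
qed

text \<open>The index set is \<open>A \<times> A\<close>: all pair projections take values in words over the same two letters of
  \<open>B\<close>, so the size of \<open>A\<close> enters only through the exponent of the power.\<close>

lemma generated_variety_subset:
  assumes P: "last_occurrence_congruence P" and Q: "last_occurrence_congruence Q"
    and B: "{1, 2} \<subseteq> B"
  shows "(generated_variety (word_quotient A P) :: 'k monoid set)
           \<subseteq> generated_variety (word_quotient B Q)"
proof (rule generated_variety_mono)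
  show "monoid (word_quotient B Q)"
    using Q monoid_word_quotient unfolding last_occurrence_congruence_def by blast
  show "HSP_with (A \<times> A) (word_quotient B Q) (word_quotient A P)"
  proof (rule HSP_with_word_quotient[where \<phi> = pair_projection])
    show "word_congruence P" "word_congruence Q"
      using P Q unfolding last_occurrence_congruence_def by blast+
    fix u v
    assume uv: "u \<in> lists A" "v \<in> lists A"
      and eq: "\<And>i. i \<in> A \<times> A \<Longrightarrow> Q (pair_projection i u) = Q (pair_projection i v)"
    have Q_eq: "count_list (pair_projection (a, b) u) = count_list (pair_projection (a, b) v) \<and>
      last (pair_projection (a, b) u) = last (pair_projection (a, b) v)"
      if "a \<in> A" "b \<in> A" for a b
      using eq[of "(a, b)"] that Q unfolding last_occurrence_congruence_def by blast
    show "P u = P v"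
      using pair_projections_separate[OF uv] Q_eq P
      unfolding last_occurrence_congruence_def by blast
  qed (use B in \<open>auto simp: pair_projection_def\<close>)
qed

lemma generated_variety_eq:
  assumes "last_occurrence_congruence P" "last_occurrence_congruence Q"
    and "{1, 2} \<subseteq> A" "{1, 2} \<subseteq> B"
  shows "(generated_variety (word_quotient A P) :: 'k monoid set) =
           generated_variety (word_quotient B Q)"
  using assms by (intro equalityI generated_variety_subset)


section \<open>Stalactic tableaux\<close>

lemma P_stal_eq: "P_stal u = map (\<lambda>a. replicate (count_list u a) a) (remdups u)"
proof (induction u)
  case Nil
  then show ?case by (simp add: P_stal_def)
next
  case (Cons b u)
  have "b \<in> \<Union> (set ` set (P_stal u)) \<longleftrightarrow> b \<in> set u"
    by (auto simp: Cons.IH count_list_0_iff)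
  moreover have "P_stal (b # u) = stal_insert b (P_stal u)" by (simp add: P_stal_def)
  ultimately show ?case
    by (auto simp: stal_insert_def Cons.IH replicate_append_same count_list_0_iff
        intro!: map_cong)
qed

lemma P_stal_eq_iff:
  "P_stal u = P_stal v \<longleftrightarrow> count_list u = count_list v \<and> remdups u = remdups v"
proof
  assume eq: "P_stal u = P_stal v"
  have "remdups w = map hd (P_stal w)" for w
    by (auto simp: P_stal_eq count_list_0_iff intro!: map_idI[symmetric])
  with eq have rd: "remdups u = remdups v" by simp
  then have "set u = set v" by (metis set_remdups)
  have "count_list u a = count_list v a" for a
  proof (cases "a \<in> set u")
    case True
    have "map (\<lambda>a. replicate (count_list u a) a) (remdups v) =
          map (\<lambda>a. replicate (count_list v a) a) (remdups v)"
      using eq rd by (simp only: P_stal_eq)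
    with True \<open>set u = set v\<close> show ?thesis by simp
  qed (use \<open>set u = set v\<close> in auto)
  with rd show "count_list u = count_list v \<and> remdups u = remdups v" by auto
qed (simp add: P_stal_eq)

lemma last_occurrence_congruence_P_stal: "last_occurrence_congruence P_stal"
proof -
  have remdups_append: "remdups (u @ v) = filter (\<lambda>a. a \<notin> set (remdups v)) (remdups u) @ remdups v"
    for u v :: "nat list"
    by (induction u) auto
  have "word_congruence P_stal"
    unfolding word_congruence_def P_stal_eq_iff
  proof (intro allI impI conjI)
    fix u u' v v' :: "nat list"
    assume u: "count_list u = count_list u' \<and> remdups u = remdups u'"
      and v: "count_list v = count_list v' \<and> remdups v = remdups v'"
    show "count_list (u @ v) = count_list (u' @ v')" using u v by (intro ext) simp
    show "remdups (u @ v) = remdups (u' @ v')" unfolding remdups_append using u v by (simp del: set_remdups)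
  qed
  moreover have "last u = last v" if "remdups u = remdups v" for u v :: "nat list"
    using that last_remdups[of u] last_remdups[of v] by argo
  ultimately show ?thesis unfolding last_occurrence_congruence_def P_stal_eq_iff by blast
qed


section \<open>Binary search trees with multiplicities\<close>

lemma P_taig_Nil: "P_taig [] = Leaf"
  by (simp add: P_taig_def)

lemma P_taig_Cons: "P_taig (a # u) = taig_insert a (P_taig u)"
  by (simp add: P_taig_def)

text \<open>The two subtrees of a nonempty tree do not interact under insertion, so a word may be
  split at the root before it is inserted.\<close>

lemma foldr_taig_insert_Node:
  "foldr taig_insert u (Node l (x, m) r) =
     Node (foldr taig_insert (filter (\<lambda>a. a < x) u) l) (x, m + count_list u x)
          (foldr taig_insert (filter (\<lambda>a. x < a) u) r)"
  by (induction u) auto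

lemma P_taig_snoc:
  "P_taig (u @ [z]) =
     Node (P_taig (filter (\<lambda>a. a < z) u)) (z, Suc (count_list u z))
          (P_taig (filter (\<lambda>a. z < a) u))"
  by (simp add: P_taig_def foldr_taig_insert_Node)

definition tree_multiplicity :: "nat \<Rightarrow> (nat \<times> nat) tree \<Rightarrow> nat" where
  "tree_multiplicity a T = (\<Sum>(x, m)\<leftarrow>inorder T. if x = a then m else 0)"

lemma tree_multiplicity_insert:
  "tree_multiplicity a (taig_insert b T) = tree_multiplicity a T + (if b = a then 1 else 0)"
  by (induction b T rule: taig_insert.induct) (auto simp: tree_multiplicity_def)

lemma tree_multiplicity_P_taig: "tree_multiplicity a (P_taig u) = count_list u a"
proof (induction u)
  case Nil
  then show ?case by (simp add: P_taig_Nil tree_multiplicity_def)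
next
  case (Cons b u)
  then show ?case by (simp add: P_taig_Cons tree_multiplicity_insert)
qed

lemma P_taig_eq_imp_count_list_eq: "P_taig u = P_taig v \<Longrightarrow> count_list u = count_list v"
  by (metis ext tree_multiplicity_P_taig)

text \<open>A monotone \<open>p\<close> splits the labels into three successive intervals by sign; for such \<open>p\<close> the
  function removes from a search tree the vertices outside the middle interval. If the root lies
  below that interval, so does its whole left subtree, and the result comes from the right subtree
  alone; dually if it lies above. Both half-lines \<open>{a. a < x}\<close> and \<open>{a. x < a}\<close> are middle
  intervals of suitable \<open>p\<close>.\<close>

fun tree_cut :: "(nat \<Rightarrow> int) \<Rightarrow> (nat \<times> nat) tree \<Rightarrow> (nat \<times> nat) tree" where
  "tree_cut p Leaf = Leaf"
| "tree_cut p (Node l (x, m) r) =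
     (if p x < 0 then tree_cut p r
      else if p x > 0 then tree_cut p l
      else Node (tree_cut p l) (x, m) (tree_cut p r))"

lemma tree_cut_insert:
  assumes "mono p"
  shows "tree_cut p (taig_insert a T) =
           (if p a = 0 then taig_insert a (tree_cut p T) else tree_cut p T)"
proof (induction a T rule: taig_insert.induct)
  case (2 a l x m r)
  have "p a \<le> p x" if "a < x" using that monoD[OF assms, of a x] by simp
  moreover have "p x \<le> p a" if "x < a" using that monoD[OF assms, of x a] by simp
  ultimately show ?case using 2 by (auto simp: not_less)
qed auto

lemma tree_cut_P_taig: "mono p \<Longrightarrow> tree_cut p (P_taig u) = P_taig (filter (\<lambda>a. p a = 0) u)"
proof (induction u)
  case Nil
  then show ?case by (simp add: P_taig_Nil)
next
  case (Cons a u)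
  then show ?case by (simp add: P_taig_Cons tree_cut_insert)
qed

text \<open>The tree of a word determines the tree of the subword on an interval of letters, because that
  tree is a cut of the original one.\<close>

lemma P_taig_filter_eq:
  assumes "P_taig u = P_taig v"
  shows "P_taig (filter (\<lambda>a. a < x) u) = P_taig (filter (\<lambda>a. a < x) v)"
    and "P_taig (filter (\<lambda>a. x < a) u) = P_taig (filter (\<lambda>a. x < a) v)"
proof -
  have "mono (\<lambda>a. if a < x then 0 else 1 :: int)" "mono (\<lambda>a. if x < a then 0 else - 1 :: int)"
    by (auto intro!: monoI)
  from this[THEN tree_cut_P_taig]
  show "P_taig (filter (\<lambda>a. a < x) u) = P_taig (filter (\<lambda>a. a < x) v)"
    and "P_taig (filter (\<lambda>a. x < a) u) = P_taig (filter (\<lambda>a. x < a) v)"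
    using assms by (simp_all add: if_distrib[of "\<lambda>k. k = 0"] cong: if_cong) metis+
qed

text \<open>By definition, words with equal trees agree when inserted into the empty tree. At a vertex \<open>x\<close>
  the letters are distributed to the subtrees, and the parts that arrive there again have equal
  trees.\<close>

lemma foldr_taig_insert_cong:
  "P_taig u = P_taig v \<Longrightarrow> foldr taig_insert u T = foldr taig_insert v T"
proof (induction T arbitrary: u v)
  case Leaf
  then show ?case by (simp add: P_taig_def)
next
  case (Node l xm r)
  obtain x m where "xm = (x, m)" by force
  then show ?case
    using Node.IH(1)[OF P_taig_filter_eq(1)[OF Node.prems]]
      Node.IH(2)[OF P_taig_filter_eq(2)[OF Node.prems]]
      P_taig_eq_imp_count_list_eq[OF Node.prems]
    by (simp add: foldr_taig_insert_Node)
qed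

lemma word_congruence_P_taig: "word_congruence P_taig"
  unfolding word_congruence_def
proof (intro allI impI)
  fix u u' v v' assume "P_taig u = P_taig u'" "P_taig v = P_taig v'"
  then have "foldr taig_insert u (P_taig v) = foldr taig_insert u' (P_taig v')"
    by (simp add: foldr_taig_insert_cong[of u u'])
  then show "P_taig (u @ v) = P_taig (u' @ v')" by (simp add: P_taig_def)
qed

lemma P_taig_eq_imp_last_eq:
  assumes "P_taig u = P_taig v"
  shows "last u = last v"
  using assms
  by (cases u rule: rev_cases; cases v rule: rev_cases; simp add: P_taig_Nil P_taig_snoc)

text \<open>The order of last occurrences fixes the last letter, hence the root, and is inherited by the
  subwords that build the two subtrees; induction on the length applies to these.\<close>

lemma P_taig_eqI:
  assumes "count_list u = count_list v" "remdups u = remdups v"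
  shows "P_taig u = P_taig v"
  using assms
proof (induction "length u" arbitrary: u v rule: less_induct)
  case less
  show ?case
  proof (cases u rule: rev_cases)
    case Nil
    then show ?thesis using less.prems(2) by (metis remdups_eq_nil_iff)
  next
    case (snoc u' z)
    then have "v \<noteq> []" "last v = z"
      using less.prems(2) by (metis remdups_eq_nil_iff snoc_eq_iff_butlast, metis last_remdups last_snoc)
    then obtain v' where v: "v = v' @ [z]" by (metis append_butlast_last_id)
    \<comment> \<open>As \<open>p\<close> rejects \<open>z\<close>, the subwords of \<open>u'\<close> and \<open>v'\<close> are those of \<open>u\<close> and \<open>v\<close>, whose content and
      last occurrences agree.\<close>
    have "P_taig (filter p u') = P_taig (filter p v')" if "\<not> p z" for p
    proof (rule less.hyps)
      show "length (filter p u') < length u" using snoc by (simp add: le_imp_less_Suc)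
      have "filter p u' = filter p u" "filter p v' = filter p v" using that snoc v by auto
      moreover have "count_list (filter p w) = (\<lambda>a. if p a then count_list w a else 0)" for w
        by (induction w) auto
      ultimately show "count_list (filter p u') = count_list (filter p v')"
        "remdups (filter p u') = remdups (filter p v')"
        using less.prems by (simp_all add: remdups_filter cong: if_cong)
    qed
    moreover have "count_list u' z = count_list v' z"
      using fun_cong[OF less.prems(1), of z] snoc v by simp
    ultimately show ?thesis using snoc v by (simp add: P_taig_snoc)
  qed
qed

lemma last_occurrence_congruence_P_taig: "last_occurrence_congruence P_taig"
  unfolding last_occurrence_congruence_def
  using word_congruence_P_taig P_taig_eq_imp_count_list_eq P_taig_eq_imp_last_eq P_taig_eqI
  by blast


section \<open>The varieties generated by the stalactic and taiga monoids\<close>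

theorem corollary5p10:
  fixes n :: nat
  assumes "n \<ge> 2"
  shows "(generated_variety stal :: 'k monoid set) = generated_variety (stal_rank n) \<and>
         (generated_variety (stal_rank n) :: 'k monoid set) = generated_variety (taig_rank n) \<and>
         (generated_variety (taig_rank n) :: 'k monoid set) = generated_variety taig"
  unfolding stal_def stal_rank_def taig_def taig_rank_def
  by (intro conjI generated_variety_eq last_occurrence_congruence_P_stal
      last_occurrence_congruence_P_taig) (use assms in auto)

end
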